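(* Let $I\subset[0,\infty)$ be an interval with interior $I^{\circ}$, and let $f:I\to\mathbb{R}$ be twice differentiable on $I^{\circ}$ with $f''\in L[a,b]$, where $a,b\in I^{\circ}$ and $a<b$. Suppose that $|f''|^{q}$ is $s$-convex (in the second sense) on $[a,b]$ for some fixed $s\in(0,1]$ and some $q>1$, and let $p=\frac{q}{q-1}$. Then for all $x\in[a,b]$, $\lambda\in[0,1]$ and $\alpha>0$, $$\left|I_f(x,\lambda,\alpha,a,b)\right|\le C_4(\alpha,\lambda,p)^{\frac1p}\left\{\frac{(x-a)^{\alpha+2}}{(\alpha+1)(b-a)}\left(\frac{|f''(x)|^{q}+|f''(a)|^{q}}{s+1}\right)^{\frac1q}+\frac{(b-x)^{\alpha+2}}{(\alpha+1)(b-a)}\left(\frac{|f''(x)|^{q}+|f''(b)|^{q}}{s+1}\right)^{\frac1q}\right\},$$ where $$C_4(\alpha,\lambda,p)=\begin{cases}\dfrac1{p(\alpha+1)+1}, & \lambda=0,\\[3mm] \dfrac{[(\alpha+1)\lambda]^{\frac{1+(\alpha+1)p}{\alpha}}}{\alpha}\,\beta\!\left(\frac{1+p}{\alpha},1+p\right)+\dfrac{[1-(\alpha+1)\lambda]^{p+1}}{\alpha(p+1)}\;{}_2F_1\!\left(1-\frac{1+p}{\alpha},1;p+2;1-(\alpha+1)\lambda\right), & 0<\lambda\le\frac1{\alpha+1},\\[3mm] \dfrac{[(\alpha+1)\lambda]^{\frac{p(\alpha+1)+1}{\alpha}}}{\alpha}\,\beta\!\left(\frac1{(\alpha+1)\lambda};\frac{1+p}{\alpha},1+p\right),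 & \frac1{\alpha+1}<\lambda\le1.\end{cases}$$
   Context: A function $g$ is $s$-convex in the second sense on $[a,b]\subset[0,\infty)$, with $s\in(0,1]$, if $g(\mu u+\nu v)\le\mu^{s}g(u)+\nu^{s}g(v)$ for all $u,v\in[a,b]$ and $\mu,\nu\ge0$ with $\mu+\nu=1$. For $x\in[a,b]$, $\lambda\in[0,1]$, $\alpha>0$, define $$I_f(x,\lambda,\alpha,a,b)=(1-\lambda)\left[\frac{(x-a)^{\alpha}+(b-x)^{\alpha}}{b-a}\right]f(x)+\lambda\left[\frac{(x-a)^{\alpha}f(a)+(b-x)^{\alpha}f(b)}{b-a}\right]+\left(\frac1{\alpha+1}-\lambda\right)\left[\frac{(b-x)^{\alpha+1}-(x-a)^{\alpha+1}}{b-a}\right]f'(x)-\frac{\Gamma(\alpha+1)}{b-a}\left[J^{\alpha}_{x^-}f(a)+J^{\alpha}_{x^+}f(b)\right],$$ where $\Gamma$ is the Gamma function and the Riemann–Liouville fractional integrals are $$J^{\alpha}_{x^-}f(a)=\frac1{\Gamma(\alpha)}\int_a^x(t-a)^{\alpha-1}f(t)\,dt,\qquad J^{\alpha}_{x^+}f(b)=\frac1{\Gamma(\alpha)}\int_x^b(b-t)^{\alpha-1}f(t)\,dt$$ (equal to $0$ when $x=a$, respectively $x=b$). Beta function: $\beta(u,v)=\int_0^1t^{u-1}(1-t)^{v-1}dt$ for $u,v>0$. Incomplete Beta function: $\beta(c;u,v)=\int_0^{c}t^{u-1}(1-t)^{v-1}dt$ for $0<c<1$, $u,v>0$. Hypergeometric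 function: ${}_2F_1(k,m;n;z)=\frac1{\beta(m,n-m)}\int_0^1t^{m-1}(1-t)^{n-m-1}(1-zt)^{-k}dt$ for $n>m>0$, $|z|<1$. *)

theory Defs
  imports "HOL-Analysis.Analysis"
begin

text \<open>
  Real powers are written with \<open>powr\<close>, so \<open>0 powr r = 0\<close> for every \<open>r\<close>. Below, zero bases occur
  either with a positive exponent, where this is the usual value, or at an endpoint of a domain of
  integration, where the value of the integrand is irrelevant. The Beta function is the library's
  \<^const>\<open>Beta\<close>; its Euler integral over \<open>[0,1]\<close> is \<open>has_integral_Beta_real\<close>.
\<close>

text \<open>\<open>s\<close>-convexity in the second sense; meant for \<open>0 < s \<le> 1\<close> and intervals \<open>S \<subseteq> [0,\<infinity>)\<close>.\<close>

definition s_convex_on :: "real \<Rightarrow> real set \<Rightarrow> (real \<Rightarrow> real) \<Rightarrow> bool" where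
  "s_convex_on s S g \<longleftrightarrow>
    (\<forall>u\<in>S. \<forall>v\<in>S. \<forall>\<mu>\<ge>0. \<forall>\<nu>\<ge>0. \<mu> + \<nu> = 1 \<longrightarrow>
      g (\<mu> * u + \<nu> * v) \<le> \<mu> powr s * g u + \<nu> powr s * g v)"

text \<open>Riemann--Liouville integrals of order \<open>\<alpha>\<close> with base point \<open>x\<close>: \<open>RL_minus \<alpha> x f y\<close> is
  \<open>J\<close> with index \<open>x-\<close> at \<open>y \<le> x\<close>, and \<open>RL_plus \<alpha> x f y\<close> is \<open>J\<close> with index \<open>x+\<close> at \<open>y \<ge> x\<close>.\<close>

definition RL_minus :: "real \<Rightarrow> real \<Rightarrow> (real \<Rightarrow> real) \<Rightarrow> real \<Rightarrow> real" where
  "RL_minus \<alpha> x f y = 1 / Gamma \<alpha> * integral {y..x} (\<lambda>t. (t - y) powr (\<alpha> - 1) * f t)"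

definition RL_plus :: "real \<Rightarrow> real \<Rightarrow> (real \<Rightarrow> real) \<Rightarrow> real \<Rightarrow> real" where
  "RL_plus \<alpha> x f y = 1 / Gamma \<alpha> * integral {x..y} (\<lambda>t. (y - t) powr (\<alpha> - 1) * f t)"

definition I_fun :: "(real \<Rightarrow> real) \<Rightarrow> real \<Rightarrow> real \<Rightarrow> real \<Rightarrow> real \<Rightarrow> real \<Rightarrow> real" where
  "I_fun f x l \<alpha> a b =
     (1 - l) * (((x - a) powr \<alpha> + (b - x) powr \<alpha>) / (b - a)) * f x
     + l * (((x - a) powr \<alpha> * f a + (b - x) powr \<alpha> * f b) / (b - a))
     + (1 / (\<alpha> + 1) - l)
         * (((b - x) powr (\<alpha> + 1) - (x - a) powr (\<alpha> + 1)) / (b - a)) * deriv f x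
     - Gamma (\<alpha> + 1) / (b - a) * (RL_minus \<alpha> x f a + RL_plus \<alpha> x f b)"

definition inc_Beta :: "real \<Rightarrow> real \<Rightarrow> real \<Rightarrow> real" where
  "inc_Beta c u v = integral {0..c} (\<lambda>t. t powr (u - 1) * (1 - t) powr (v - 1))"

text \<open>Euler's integral; meant for \<open>n > m > 0\<close> and \<open>\<bar>z\<bar> < 1\<close>.\<close>

definition hypergeom_2F1 :: "real \<Rightarrow> real \<Rightarrow> real \<Rightarrow> real \<Rightarrow> real" where
  "hypergeom_2F1 k m n z =
     1 / Beta m (n - m) *
     integral {0..1} (\<lambda>t. t powr (m - 1) * (1 - t) powr (n - m - 1) * (1 - z * t) powr (- k))"

definition C4 :: "real \<Rightarrow> real \<Rightarrow> real \<Rightarrow> real" where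
  "C4 \<alpha> l p =
    (if l = 0 then 1 / (p * (\<alpha> + 1) + 1)
     else if l \<le> 1 / (\<alpha> + 1) then
       ((\<alpha> + 1) * l) powr ((1 + (\<alpha> + 1) * p) / \<alpha>) / \<alpha> * Beta ((1 + p) / \<alpha>) (1 + p)
       + (1 - (\<alpha> + 1) * l) powr (p + 1) / (\<alpha> * (p + 1))
         * hypergeom_2F1 (1 - (1 + p) / \<alpha>) 1 (p + 2) (1 - (\<alpha> + 1) * l)
     else
       ((\<alpha> + 1) * l) powr ((p * (\<alpha> + 1) + 1) / \<alpha>) / \<alpha>
         * inc_Beta (1 / ((\<alpha> + 1) * l)) ((1 + p) / \<alpha>) (1 + p))"

end

theory Submission
  imports Defs
begin

text \<open>
  Put \<open>k(t) = t ((\<alpha> + 1) \<lambda> - t\<^sup>\<alpha>)\<close>. Two integrations by parts turn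
  \<open>\<integral>\<^sub>0\<^sup>1 k(t) f''(t x + (1 - t) y) dt\<close>, for \<open>y = a\<close> and \<open>y = b\<close>, into the part of \<open>I\<^sub>f\<close> belonging to
  the endpoint \<open>y\<close>, up to the factor \<open>\<bar>x - y\<bar> powr (\<alpha> + 2) / ((\<alpha> + 1) (b - a))\<close>. By \<open>s\<close>-convexity,
  \<open>\<bar>f''(t x + (1 - t) y)\<bar>\<close> is at most the \<open>q\<close>-th root of \<open>t\<^sup>s \<bar>f''(x)\<bar>\<^sup>q + (1 - t)\<^sup>s \<bar>f''(y)\<bar>\<^sup>q\<close>,
  whose integral is \<open>(\<bar>f''(x)\<bar>\<^sup>q + \<bar>f''(y)\<bar>\<^sup>q) / (s + 1)\<close>. Hoelder's inequality applied to \<open>\<bar>k\<bar>\<close> and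
  this continuous majorant gives the claim, since \<open>C4\<close> is \<open>\<integral>\<^sub>0\<^sup>1 \<bar>k(t)\<bar>\<^sup>p dt\<close>: substitute
  \<open>t\<^sup>\<alpha> = L v\<close> where \<open>k \<ge> 0\<close> and \<open>t\<^sup>\<alpha> = 1 - (1 - L) v\<close> where \<open>k < 0\<close>, with \<open>L = (\<alpha> + 1) \<lambda>\<close>.
\<close>

section \<open>Hoelder's inequality\<close>

text \<open>Young's inequality is applied pointwise to the normalised factors and then integrated;
  the normalised product has integral at most \<open>1 / p + 1 / q = 1\<close>.\<close>

lemma integral_Holder:
  fixes F G :: "'a::euclidean_space \<Rightarrow> real"
  assumes pq: "p > 1" "q > 1" "1 / p + 1 / q = 1"
    and nonneg: "\<And>t. t \<in> S \<Longrightarrow> 0 \<le> F t" "\<And>t. t \<in> S \<Longrightarrow> 0 \<le> G t"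
    and int_F: "(\<lambda>t. F t powr p) integrable_on S"
    and int_G: "(\<lambda>t. G t powr q) integrable_on S"
    and int_FG: "(\<lambda>t. F t * G t) integrable_on S"
  shows "integral S (\<lambda>t. F t * G t)
    \<le> integral S (\<lambda>t. F t powr p) powr (1 / p) * integral S (\<lambda>t. G t powr q) powr (1 / q)"
proof -
  define A where "A = integral S (\<lambda>t. F t powr p)"
  define B where "B = integral S (\<lambda>t. G t powr q)"
  have A: "A \<ge> 0" and B: "B \<ge> 0"
    unfolding A_def B_def by (auto intro!: integral_nonneg int_F int_G)
  \<comment> \<open>The integrals may vanish, so they are enlarged by \<open>e\<close> before normalising; then \<open>e \<rightarrow> 0\<close>.\<close>
  have bound: "integral S (\<lambda>t. F t * G t) \<le> (A + e) powr (1 / p) * (B + e) powr (1 / q)"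
    if e: "e > 0" for e
  proof -
    define r where "r = (A + e) powr (1 / p)"
    define s where "s = (B + e) powr (1 / q)"
    have r: "r > 0" "r powr p = A + e" and s: "s > 0" "s powr q = B + e"
      using A B e pq by (auto simp: r_def s_def powr_powr)
    have "F t * G t \<le> r * s * (F t powr p / (p * (A + e)) + G t powr q / (q * (B + e)))"
      if "t \<in> S" for t
    proof -
      have "(F t / r) * (G t / s) \<le> (F t / r) powr p / p + (G t / s) powr q / q"
        using r s nonneg[OF that] by (intro Youngs_inequality pq) auto
      also have "\<dots> = F t powr p / (p * (A + e)) + G t powr q / (q * (B + e))"
        using r s nonneg[OF that] by (simp add: powr_divide mult.commute)
      finally show ?thesis
        using r s by (simp add: field_simps)
    qed
    then have "integral S (\<lambda>t. F t * G t)
        \<le> integral S (\<lambda>t. r * s * (F t powr p / (p * (A + e)) + G t powr q / (q * (B + e))))"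
      by (intro integral_le int_FG integrable_on_mult_right integrable_add integrable_on_divide
          int_F int_G)
    also have "\<dots> = r * s * (A / (p * (A + e)) + B / (q * (B + e)))"
      unfolding A_def B_def
      by (simp add: integral_add integrable_on_divide int_F int_G)
    also have "\<dots> \<le> r * s * (1 / p + 1 / q)"
      using A B e pq r s
      by (intro mult_left_mono add_mono) (auto simp: divide_simps)
    finally show ?thesis
      using pq by (simp add: r_def s_def)
  qed
  \<comment> \<open>Positive exponents make \<open>powr\<close> continuous from the right at base 0,
    which covers \<open>A = 0\<close> and \<open>B = 0\<close>.\<close>
  have pos: "0 < 1 / p" "0 < 1 / q" using pq by auto
  have "((\<lambda>e. (A + e) powr (1 / p) * (B + e) powr (1 / q)) \<longlongrightarrow> (A + 0) powr (1 / p) * (B + 0) powr (1 / q))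
      (at_right 0)"
    using A B pos
    by (intro tendsto_intros tendsto_powr')
      (auto intro!: eventually_mono[OF eventually_at_right_less])
  moreover have "\<forall>\<^sub>F e in at_right 0. integral S (\<lambda>t. F t * G t) \<le> (A + e) powr (1 / p) * (B + e) powr (1 / q)"
    using bound by (auto simp: eventually_at_right_field intro!: exI[of _ 1])
  ultimately have "integral S (\<lambda>t. F t * G t) \<le> (A + 0) powr (1 / p) * (B + 0) powr (1 / q)"
    by (rule tendsto_lowerbound) simp
  then show ?thesis by (simp add: A_def B_def)
qed

section \<open>The integral identity on the unit interval\<close>

text \<open>Both integrations by parts start from the middle integral \<open>J\<close>, whose
  integrand is continuous. Each transfers integrability from there to an outer integrand: the one
  with \<open>\<phi>\<close> and the one with \<open>\<phi>''\<close>.\<close>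

lemma kernel_by_parts:
  fixes \<phi> \<phi>' \<phi>'' :: "real \<Rightarrow> real"
  assumes \<alpha>: "\<alpha> > 0"
    and d1: "\<And>t. t \<in> {0..1} \<Longrightarrow> (\<phi> has_real_derivative \<phi>' t) (at t)"
    and d2: "\<And>t. t \<in> {0..1} \<Longrightarrow> (\<phi>' has_real_derivative \<phi>'' t) (at t)"
  shows "(\<lambda>t. t powr (\<alpha> - 1) * \<phi> t) integrable_on {0..1}"
    and "((\<lambda>t. t * ((\<alpha> + 1) * l - t powr \<alpha>) * \<phi>'' t) has_integral
          ((\<alpha> + 1) * l - 1) * \<phi>' 1 + (\<alpha> + 1) *
            ((1 - l) * \<phi> 1 + l * \<phi> 0 - \<alpha> * integral {0..1} (\<lambda>t. t powr (\<alpha> - 1) * \<phi> t))) {0..1}"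
proof -
  have c1: "continuous_on {0..1} \<phi>" and c2: "continuous_on {0..1} \<phi>'"
    by (blast intro: continuous_at_imp_continuous_on DERIV_isCont d1 d2)+
  have cw: "continuous_on {0..1} (\<lambda>t. l - t powr \<alpha>)" for l
    using \<alpha> by (intro continuous_intros continuous_on_powr') auto
  define J where "J = integral {0..1} (\<lambda>t. (l - t powr \<alpha>) * \<phi>' t)"
  have J: "((\<lambda>t. (l - t powr \<alpha>) * \<phi>' t) has_integral J) {0..1}"
    unfolding J_def
    by (intro integrable_integral integrable_continuous_interval continuous_on_mult cw c2)
  \<comment> \<open>For \<open>\<alpha> < 1\<close> the factor \<open>t powr (\<alpha> - 1)\<close>
    is unbounded near 0, so the version asking for derivatives only in the interior is used.\<close>
  have *: "((\<lambda>t. (- \<alpha> * t powr (\<alpha> - 1)) * \<phi> t) has_integral ((l - 1) * \<phi> 1 - l * \<phi> 0 - J)) {0..1}"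
    by (rule integration_by_parts_interior
        [OF bounded_bilinear_mult, where f = "\<lambda>t. l - t powr \<alpha>" and g' = \<phi>'])
      (use J \<alpha> in \<open>auto intro!: cw c1 d1 derivative_eq_intros
        simp flip: has_real_derivative_iff_has_vector_derivative\<close>)
  from has_integral_mult_right[OF *, of "- 1 / \<alpha>"] \<alpha>
  have M: "((\<lambda>t. t powr (\<alpha> - 1) * \<phi> t) has_integral (- 1 / \<alpha>) * ((l - 1) * \<phi> 1 - l * \<phi> 0 - J)) {0..1}"
    by (simp add: mult.assoc)
  then show "(\<lambda>t. t powr (\<alpha> - 1) * \<phi> t) integrable_on {0..1}"
    by blast
  define k where "k = (\<lambda>t. t * ((\<alpha> + 1) * l - t powr \<alpha>))"
  \<comment> \<open>The factor \<open>\<alpha> + 1\<close> in front of \<open>l\<close> is chosen so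
    that the derivative of \<open>k\<close> is a multiple of the weight in \<open>J\<close>. At the
    ends, \<open>k 0 = 0\<close> and \<open>k 1 = (\<alpha> + 1) * l - 1\<close>.\<close>
  have dk: "(k has_real_derivative (\<alpha> + 1) * (l - t powr \<alpha>)) (at t)" if "t > 0" for t
    using that unfolding k_def
    by (auto intro!: derivative_eq_intros simp: powr_diff field_simps)
  have ck: "continuous_on {0..1} k"
    unfolding k_def by (intro continuous_on_mult continuous_on_id cw)
  have "((\<lambda>t. \<phi>'' t * k t) has_integral \<phi>' 1 * k 1 - \<phi>' 0 * k 0 - (\<alpha> + 1) * J) {0..1}"
  proof (rule integration_by_parts_interior
        [OF bounded_bilinear_mult, where f = \<phi>' and g' = "\<lambda>t. (\<alpha> + 1) * (l - t powr \<alpha>)"])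
    show "((\<lambda>t. \<phi>' t * ((\<alpha> + 1) * (l - t powr \<alpha>))) has_integral
      \<phi>' 1 * k 1 - \<phi>' 0 * k 0 - (\<phi>' 1 * k 1 - \<phi>' 0 * k 0 - (\<alpha> + 1) * J)) {0..1}"
      using has_integral_mult_right[OF J, of "\<alpha> + 1"] by (simp add: mult_ac)
  qed (use ck c2 d2 dk in \<open>auto simp flip: has_real_derivative_iff_has_vector_derivative\<close>)
  moreover have "J = (l - 1) * \<phi> 1 - l * \<phi> 0 + \<alpha> * integral {0..1} (\<lambda>t. t powr (\<alpha> - 1) * \<phi> t)"
    using integral_unique[OF M] \<alpha> by (simp add: field_simps)
  ultimately show "((\<lambda>t. t * ((\<alpha> + 1) * l - t powr \<alpha>) * \<phi>'' t) has_integral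
          ((\<alpha> + 1) * l - 1) * \<phi>' 1 + (\<alpha> + 1) *
            ((1 - l) * \<phi> 1 + l * \<phi> 0 - \<alpha> * integral {0..1} (\<lambda>t. t powr (\<alpha> - 1) * \<phi> t))) {0..1}"
    by (simp add: k_def algebra_simps)
qed

section \<open>Evaluation of \<open>C4\<close> as an integral\<close>

lemma continuous_kernel_powr:
  fixes \<alpha> p L :: real
  assumes "\<alpha> > 0" "p > 0" "S \<subseteq> {0..}"
  shows "continuous_on S (\<lambda>t. (t * \<bar>L - t powr \<alpha>\<bar>) powr p)"
  using assms by (intro continuous_intros continuous_on_powr') auto

text \<open>The free limit \<open>w\<close> serves two cases: \<open>w = 1\<close> ends at the zero
  of the kernel and gives the complete Beta function, while \<open>w = 1 / L\<close> ends at
  \<open>t = 1\<close>.\<close>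

lemma kernel_integral_inc_Beta:
  assumes \<alpha>: "\<alpha> > 0" and p: "p > 0" and L: "L > 0" and w: "0 \<le> w" "w \<le> 1"
  shows "integral {0..(L * w) powr (1 / \<alpha>)} (\<lambda>t. (t * \<bar>L - t powr \<alpha>\<bar>) powr p)
    = L powr ((1 + (\<alpha> + 1) * p) / \<alpha>) / \<alpha> * inc_Beta w ((1 + p) / \<alpha>) (1 + p)"
proof -
  define F where "F = (\<lambda>t. (t * \<bar>L - t powr \<alpha>\<bar>) powr p)"
  define g where "g = (\<lambda>v. (L * v) powr (1 / \<alpha>))"
  define g' where "g' = (\<lambda>v. L powr (1 / \<alpha>) / \<alpha> * v powr (1 / \<alpha> - 1))"
  define C where "C = L powr ((1 + (\<alpha> + 1) * p) / \<alpha>) / \<alpha>"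
  have subst: "((\<lambda>v. g' v *\<^sub>R F (g v)) has_integral integral {g 0..g w} F - integral {g w..g 0} F) {0..w}"
    \<comment> \<open>substituting in this direction keeps the substituted integrand continuous\<close>
  proof (rule has_integral_substitution_general[where s = "{0}" and c = 0 and d = "g w"])
    show "g ` {0..w} \<subseteq> {0..g w}"
      using \<alpha> L by (auto simp: g_def intro!: powr_mono2 mult_left_mono)
    show "continuous_on {0..g w} F"
      unfolding F_def using \<alpha> p by (intro continuous_kernel_powr) auto
    show "continuous_on {0..w} g"
      unfolding g_def using \<alpha> L by (intro continuous_intros continuous_on_powr') auto
    \<comment> \<open>The origin is the exceptional point: for \<open>\<alpha> > 1\<close> the power
      \<open>v powr (1 / \<alpha> - 1)\<close> is unbounded near it.\<close>
    show "(g has_real_derivative g' v) (at v within {0..w})" if "v \<in> {0..w} - {0}" for v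
    proof -
      from that have "v > 0" by auto
      then show ?thesis using \<alpha> L unfolding g_def g'_def
        by (auto intro!: derivative_eq_intros simp: powr_mult powr_diff field_simps)
    qed
  qed (use w in auto)
  have g: "g 0 = 0" "g w \<ge> 0" by (auto simp: g_def)
  \<comment> \<open>The substitution rule yields a signed difference; the reversed interval is empty
    or a single point.\<close>
  have "integral {g w..g 0} F = 0"
    using g by (cases "g w = 0") auto
  with subst g have "integral {0..g w} F = integral {0..w} (\<lambda>v. g' v * F (g v))"
    by (simp add: integral_unique)
  also have "\<dots> = integral {0..w} (\<lambda>v. C * (v powr ((1 + p) / \<alpha> - 1) * (1 - v) powr (1 + p - 1)))"
  proof (rule integral_spike[of "{0}"])
    fix v assume v: "v \<in> {0..w} - {0}"
    then have "v > 0" "v \<le> 1" using w by auto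
    have gv: "g v powr \<alpha> = L * v"
      using \<alpha> L \<open>v > 0\<close> by (simp add: g_def powr_powr)
    have "L - L * v = L * (1 - v)" by (simp add: algebra_simps)
    with gv have "F (g v) = (L * v) powr (p / \<alpha>) * (L * (1 - v)) powr p"
      using L \<open>v \<le> 1\<close> \<open>v > 0\<close> by (simp add: F_def powr_mult g_def powr_powr)
    also have "\<dots> = L powr (p / \<alpha> + p) * (v powr (p / \<alpha>) * (1 - v) powr p)"
      using L \<open>v \<le> 1\<close> \<open>v > 0\<close> by (simp add: powr_mult powr_add)
    finally have F: "F (g v) = L powr (p / \<alpha> + p) * (v powr (p / \<alpha>) * (1 - v) powr p)" .
    have "g' v * F (g v) = (L powr (1 / \<alpha>) * L powr (p / \<alpha> + p)) / \<alpha>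
        * ((v powr (1 / \<alpha> - 1) * v powr (p / \<alpha>)) * (1 - v) powr p)"
      unfolding F g'_def by simp
    also have "L powr (1 / \<alpha>) * L powr (p / \<alpha> + p) = L powr ((1 + (\<alpha> + 1) * p) / \<alpha>)"
      using \<alpha> by (subst powr_add[symmetric]) (simp add: field_simps)
    also have "v powr (1 / \<alpha> - 1) * v powr (p / \<alpha>) = v powr ((1 + p) / \<alpha> - 1)"
      by (subst powr_add[symmetric]) (simp add: add_divide_distrib algebra_simps)
    finally show "C * (v powr ((1 + p) / \<alpha> - 1) * (1 - v) powr (1 + p - 1)) = g' v * F (g v)"
      by (simp add: C_def)
  qed auto
  also have "\<dots> = C * inc_Beta w ((1 + p) / \<alpha>) (1 + p)"
    by (simp add: inc_Beta_def)
  finally show ?thesis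
    by (simp add: F_def g_def C_def)
qed

text \<open>With \<open>z = 1 - L\<close> the substitution is
  \<open>t = (1 - z * v) powr (1 / \<alpha>)\<close>. Since \<open>1 - z * v \<ge> L > 0\<close>, it
  is differentiable on the whole unit interval, and it reverses orientation.\<close>

lemma kernel_integral_hypergeom:
  assumes \<alpha>: "\<alpha> > 0" and p: "p > 0" and L: "0 < L" "L \<le> 1"
  shows "integral {L powr (1 / \<alpha>)..1} (\<lambda>t. (t * \<bar>L - t powr \<alpha>\<bar>) powr p)
    = (1 - L) powr (p + 1) / (\<alpha> * (p + 1)) * hypergeom_2F1 (1 - (1 + p) / \<alpha>) 1 (p + 2) (1 - L)"
proof -
  define F where "F = (\<lambda>t. (t * \<bar>L - t powr \<alpha>\<bar>) powr p)"
  define z where "z = 1 - L"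
  have z: "0 \<le> z" "z < 1" using L by (auto simp: z_def)
  have zv: "0 < 1 - z * v" "1 - z * v \<le> 1" if "v \<in> {0..1}" for v
  proof -
    have "z * v \<le> z * 1" using that z by (intro mult_left_mono) auto
    then show "0 < 1 - z * v" "1 - z * v \<le> 1" using that z by auto
  qed
  define g where "g = (\<lambda>v. (1 - z * v) powr (1 / \<alpha>))"
  define g' where "g' = (\<lambda>v. - (z / \<alpha>) * (1 - z * v) powr (1 / \<alpha> - 1))"
  have subst: "((\<lambda>v. g' v *\<^sub>R F (g v)) has_integral integral {g 0..g 1} F - integral {g 1..g 0} F) {0..1}"
  proof (rule has_integral_substitution_general[where s = "{}" and c = 0 and d = 1])
    show "g ` {0..1} \<subseteq> {0..1}"
    proof
      fix u assume "u \<in> g ` {0..1}"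
      then obtain v where v: "v \<in> {0..1}" "u = g v" by blast
      with zv[OF v(1)] \<alpha> have "u \<le> 1" by (simp add: g_def powr_le1)
      with v show "u \<in> {0..1}" by (simp add: g_def)
    qed
    show "continuous_on {0..1} F"
      unfolding F_def using \<alpha> p by (intro continuous_kernel_powr) auto
    show deriv: "(g has_real_derivative g' v) (at v within {0..1})" if "v \<in> {0..1} - {}" for v
      using \<alpha> zv[of v] that unfolding g_def g'_def
      by (auto intro!: derivative_eq_intros simp: powr_diff field_simps)
    then show "continuous_on {0..1} g"
      by (intro DERIV_continuous_on) auto
  qed auto
  have g: "g 0 = 1" "g 1 = L powr (1 / \<alpha>)" "g 1 \<le> 1"
    using L \<alpha> by (auto simp: g_def z_def intro!: powr_le1)
  \<comment> \<open>As \<open>g\<close> runs from 1 down to \<open>L powr (1 / \<alpha>)\<close>,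
    here the forward interval degenerates and a minus sign remains; it cancels the one in
    \<open>g'\<close>.\<close>
  have "integral {g 0..g 1} F = 0"
    using g by (cases "g 1 = 1") auto
  with subst g have "integral {L powr (1 / \<alpha>)..1} F = - integral {0..1} (\<lambda>v. g' v * F (g v))"
    by (simp add: integral_unique)
  also have "integral {0..1} (\<lambda>v. g' v * F (g v)) = integral {0..1} (\<lambda>v. - (z powr (p + 1) / \<alpha>) *
      (v powr (1 - 1) * (1 - v) powr (p + 2 - 1 - 1) * (1 - z * v) powr (- (1 - (1 + p) / \<alpha>))))"
  \<comment> \<open>The point 0 is left out because \<open>0 powr 0 = 0\<close>: the factor
    \<open>v powr (1 - 1)\<close> equals 1 only for \<open>v > 0\<close>.\<close>
  proof (rule integral_spike[of "{0}"])
    fix v :: real assume v: "v \<in> {0..1} - {0}"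
    then have v': "v > 0" "v \<le> 1" by auto
    have gv: "g v powr \<alpha> = 1 - z * v"
      using \<alpha> zv[of v] v by (simp add: g_def powr_powr)
    have "L - (1 - z * v) = - (z * (1 - v))" by (simp add: z_def algebra_simps)
    with gv have "F (g v) = (g v * (z * (1 - v))) powr p"
      using z v' by (simp add: F_def abs_mult)
    also have "\<dots> = (1 - z * v) powr (p / \<alpha>) * (z powr p * (1 - v) powr p)"
      using z v' by (simp add: powr_mult g_def powr_powr)
    finally have "g' v * F (g v) = - ((z * z powr p) / \<alpha>) * ((1 - v) powr p *
       ((1 - z * v) powr (1 / \<alpha> - 1) * (1 - z * v) powr (p / \<alpha>)))"
      by (simp add: g'_def)
    also have "z * z powr p = z powr (p + 1)"
      using z p by (cases "z = 0") (simp_all add: powr_add)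
    also have "(1 - z * v) powr (1 / \<alpha> - 1) * (1 - z * v) powr (p / \<alpha>)
        = (1 - z * v) powr (- (1 - (1 + p) / \<alpha>))"
      by (subst powr_add[symmetric]) (simp add: add_divide_distrib algebra_simps)
    finally show "- (z powr (p + 1) / \<alpha>) *
      (v powr (1 - 1) * (1 - v) powr (p + 2 - 1 - 1) * (1 - z * v) powr (- (1 - (1 + p) / \<alpha>)))
       = g' v * F (g v)"
      using v' by simp
  qed auto
  \<comment> \<open>The factor \<open>1 / (p + 1)\<close> is \<open>Beta 1 (p + 1)\<close>, the
    normalisation of \<open>hypergeom_2F1\<close> at these parameters.\<close>
  also have "\<dots> = - (z powr (p + 1) / \<alpha>) * (1 / (p + 1) * hypergeom_2F1 (1 - (1 + p) / \<alpha>) 1 (p + 2) z)"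
  proof -
    have "Gamma (p + 1 + 1) = (p + 1) * Gamma (p + 1)" and pos: "Gamma (p + 1) > 0"
      using p by (intro Gamma_plus1 Gamma_real_pos; auto elim!: nonpos_Ints_cases)+
    then have "Beta 1 (p + 1) = Gamma (p + 1) / ((p + 1) * Gamma (p + 1))"
      by (simp add: Beta_def add.commute)
    also have "\<dots> = 1 / (p + 1)"
      using pos by (intro nonzero_divide_mult_cancel_right) linarith
    finally show ?thesis using p by (simp add: hypergeom_2F1_def add_ac)
  qed
  finally show ?thesis
    by (simp add: F_def z_def)
qed

text \<open>The cases of \<open>C4\<close> record where the kernel changes sign,
  \<open>t = L powr (1 / \<alpha>)\<close>: at 0, inside the unit interval or at its right end, or
  beyond 1. In the middle case the integral is split there.\<close>

lemma C4_eq_integral: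
  assumes \<alpha>: "\<alpha> > 0" and p: "p > 0" and l: "l \<ge> 0"
  shows "C4 \<alpha> l p = integral {0..1} (\<lambda>t. (t * \<bar>(\<alpha> + 1) * l - t powr \<alpha>\<bar>) powr p)"
proof -
  define L where "L = (\<alpha> + 1) * l"
  define F where "F = (\<lambda>t. (t * \<bar>L - t powr \<alpha>\<bar>) powr p)"
  have "C4 \<alpha> l p = integral {0..1} F"
  proof (cases "l = 0")
    case True
    have "integral {0..1} F = integral {0..1} (\<lambda>t. t powr (p * (\<alpha> + 1)))"
    proof (rule integral_cong)
      fix t :: real assume "t \<in> {0..1}"
      then have "t * t powr \<alpha> = t powr (\<alpha> + 1)"
        using \<alpha> by (cases "t = 0") (auto simp: powr_add)
      then show "F t = t powr (p * (\<alpha> + 1))"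
        using True by (simp add: F_def L_def powr_powr mult.commute)
    qed
    also have "\<dots> = 1 powr (p * (\<alpha> + 1) + 1) / (p * (\<alpha> + 1) + 1)"
      using \<alpha> p by (intro integral_unique has_integral_powr_from_0) (auto intro: less_le_trans[of _ 0])
    finally show ?thesis using True by (simp add: C4_def)
  next
    case False
    then have L: "L > 0" using l \<alpha> by (simp add: L_def)
    have L_iff: "l \<le> 1 / (\<alpha> + 1) \<longleftrightarrow> L \<le> 1"
      using \<alpha> by (simp add: L_def field_simps)
    show ?thesis
    proof (cases "L \<le> 1")
      case True
      have "inc_Beta 1 ((1 + p) / \<alpha>) (1 + p) = Beta ((1 + p) / \<alpha>) (1 + p)"
        unfolding inc_Beta_def using \<alpha> p
        by (intro integral_unique has_integral_Beta_real) auto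
      with kernel_integral_inc_Beta[OF \<alpha> p L, of 1]
      have 1: "integral {0..L powr (1 / \<alpha>)} F
          = L powr ((1 + (\<alpha> + 1) * p) / \<alpha>) / \<alpha> * Beta ((1 + p) / \<alpha>) (1 + p)"
        by (simp add: F_def)
      have "F integrable_on {0..1}"
        unfolding F_def using \<alpha> p
        by (intro integrable_continuous_interval continuous_kernel_powr) auto
      then have "integral {0..1} F = integral {0..L powr (1 / \<alpha>)} F + integral {L powr (1 / \<alpha>)..1} F"
        using True L \<alpha> by (intro Henstock_Kurzweil_Integration.integral_combine[symmetric]) (auto intro: powr_le1)
      then show ?thesis
        using kernel_integral_hypergeom[OF \<alpha> p L True] False True L_iff
        by (simp add: 1 C4_def flip: L_def F_def)
    next
      case gt: False
      then show ?thesis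
        using kernel_integral_inc_Beta[OF \<alpha> p L, of "1 / L"] False L_iff L
        by (simp add: C4_def mult.commute[of p] add.commute[of "_ * p" 1] flip: L_def F_def)
    qed
  qed
  then show ?thesis by (simp add: F_def L_def)
qed

section \<open>The estimate on one side of \<open>x\<close>\<close>

text \<open>The function \<open>g\<close> is replaced by the majorant \<open>G\<close> before
  Hoelder's inequality is used, so the integrability required there follows from continuity and from
  explicit power integrals.\<close>

lemma kernel_integral_bound:
  fixes g :: "real \<Rightarrow> real"
  assumes \<alpha>: "\<alpha> > 0" and l: "l \<ge> 0" and s: "s > 0"
    and pq: "p > 1" "q > 1" "1 / p + 1 / q = 1"
    and AB: "A \<ge> 0" "B \<ge> 0"
    and g: "\<And>t. t \<in> {0..1} \<Longrightarrow> \<bar>g t\<bar> powr q \<le> t powr s * A + (1 - t) powr s * B"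
    and int: "((\<lambda>t. t * ((\<alpha> + 1) * l - t powr \<alpha>) * g t) has_integral N) {0..1}"
  shows "\<bar>N\<bar> \<le> C4 \<alpha> l p powr (1 / p) * ((A + B) / (s + 1)) powr (1 / q)"
proof -
  define G where "G = (\<lambda>t. (t powr s * A + (1 - t) powr s * B) powr (1 / q))"
  define K where "K = (\<lambda>t. t * \<bar>(\<alpha> + 1) * l - t powr \<alpha>\<bar>)"
  have pos: "t powr s * A + (1 - t) powr s * B \<ge> 0" for t
    using AB by simp
  have Gq: "G t powr q = t powr s * A + (1 - t) powr s * B" for t
    using pos[of t] pq by (simp add: G_def powr_powr)
  have i1: "((\<lambda>t. t powr s) has_integral 1 / (s + 1)) {0..1}"
    using has_integral_powr_from_0[of s 1] s by simp
  \<comment> \<open>The reflection of \<open>t\<close> to \<open>1 - t\<close> carries over the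
    previous integral.\<close>
  then have "((\<lambda>t. (1 - t) powr s) has_integral 1 / (s + 1)) {0..1}"
    using has_integral_affinity[of "\<lambda>t. t powr s" "1 / (s + 1)" 0 "1::real" "-1" 1]
    by (simp add: image_affinity_atLeastAtMost algebra_simps)
  from has_integral_add[OF has_integral_mult_left[OF i1, of A] has_integral_mult_left[OF this, of B]]
  have iG: "((\<lambda>t. G t powr q) has_integral (A + B) / (s + 1)) {0..1}"
    by (simp add: Gq add_divide_distrib)
  have cK: "continuous_on {0..1} K"
    unfolding K_def using \<alpha> by (intro continuous_intros continuous_on_powr') auto
  have cG: "continuous_on {0..1} G"
    unfolding G_def using s pq pos by (intro continuous_intros continuous_on_powr') auto
  have iKG: "(\<lambda>t. K t * G t) integrable_on {0..1}"
    by (intro integrable_continuous_interval continuous_on_mult cK cG)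
  have "\<bar>N\<bar> \<le> integral {0..1} (\<lambda>t. K t * G t)"
    unfolding integral_unique[OF int, symmetric] real_norm_def[symmetric]
  proof (rule integral_norm_bound_integral)
    fix t :: real assume t: "t \<in> {0..1}"
    have "\<bar>g t\<bar> = (\<bar>g t\<bar> powr q) powr (1 / q)"
      using pq by (simp add: powr_powr)
    also have "\<dots> \<le> G t"
      unfolding G_def using g[OF t] pq by (intro powr_mono2) auto
    finally show "norm (t * ((\<alpha> + 1) * l - t powr \<alpha>) * g t) \<le> K t * G t"
      using t by (auto simp: K_def abs_mult intro!: mult_left_mono)
  qed (use int iKG in auto)
  also have "\<dots> \<le> integral {0..1} (\<lambda>t. K t powr p) powr (1 / p) *
      integral {0..1} (\<lambda>t. G t powr q) powr (1 / q)"
  proof (rule integral_Holder[OF pq _ _ _ _ iKG])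
    show "(\<lambda>t. K t powr p) integrable_on {0..1}"
      unfolding K_def using \<alpha> pq
      by (intro integrable_continuous_interval continuous_kernel_powr) auto
  qed (use iG in \<open>auto simp: K_def G_def\<close>)
  also have "integral {0..1} (\<lambda>t. K t powr p) = C4 \<alpha> l p"
    unfolding K_def using \<alpha> l pq by (intro C4_eq_integral[symmetric]) auto
  finally show ?thesis
    by (simp add: integral_unique[OF iG])
qed

text \<open>Segments and absolute values treat \<open>y < x\<close> and \<open>x < y\<close> at
  once. Under \<open>u = y + t * (x - y)\<close> the weight contributes
  \<open>\<bar>x - y\<bar> powr (\<alpha> - 1)\<close> and the change of variable one more factor
  \<open>\<bar>x - y\<bar>\<close>.\<close>

lemma has_integral_closed_segment:
  fixes f :: "real \<Rightarrow> real"
  assumes xy: "x \<noteq> y"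
    and int: "((\<lambda>t. t powr (\<alpha> - 1) * f (y + t * (x - y))) has_integral M) {0..1}"
  shows "((\<lambda>u. \<bar>u - y\<bar> powr (\<alpha> - 1) * f u) has_integral \<bar>x - y\<bar> powr \<alpha> * M) (closed_segment y x)"
proof -
  define h where "h = x - y"
  have h: "h \<noteq> 0" using xy by (simp add: h_def)
  have "((\<lambda>u. (u / h - y / h) powr (\<alpha> - 1) * f (y + (u / h - y / h) * h)) has_integral \<bar>h\<bar> * M)
      ((\<lambda>t. h * t + y) ` {0..1})"
    using has_integral_affinity[of _ M 0 "1::real" "1 / h" "- (y / h)"] int h
    by (simp add: h_def)
  also have "(\<lambda>t. h * t + y) ` {0..1} = closed_segment y x"
    by (simp add: closed_segment_real_eq h_def)
  finally have "((\<lambda>u. \<bar>h\<bar> powr (\<alpha> - 1) * ((u / h - y / h) powr (\<alpha> - 1) * f (y + (u / h - y / h) * h)))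
      has_integral \<bar>h\<bar> powr (\<alpha> - 1) * (\<bar>h\<bar> * M)) (closed_segment y x)"
    by (rule has_integral_mult_right)
  also have "\<bar>h\<bar> powr (\<alpha> - 1) * (\<bar>h\<bar> * M) = \<bar>h\<bar> powr \<alpha> * M"
    using h by (simp add: powr_diff)
  finally show ?thesis unfolding h_def[symmetric]
  proof (rule has_integral_eq[rotated])
    fix u assume "u \<in> closed_segment y x"
    then obtain t where t: "t \<in> {0..1}" "u = h * t + y"
      by (auto simp: closed_segment_real_eq h_def)
    then have "u / h - y / h = t" "\<bar>u - y\<bar> = \<bar>h\<bar> * t" "y + t * h = u"
      using h by (simp_all add: add_divide_distrib abs_mult)
    then show "\<bar>h\<bar> powr (\<alpha> - 1) * ((u / h - y / h) powr (\<alpha> - 1) * f (y + (u / h - y / h) * h))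
        = \<bar>u - y\<bar> powr (\<alpha> - 1) * f u"
      using t(1) by (simp add: powr_mult)
  qed
qed

text \<open>The signed factor \<open>x - y\<close> next to \<open>f' x\<close> produces the opposite
  signs with which the two endpoints enter the derivative term of \<open>I_fun\<close>. For
  \<open>x = y\<close> both sides vanish.\<close>

lemma one_sided_bound:
  fixes f f' f'' :: "real \<Rightarrow> real"
  assumes \<alpha>: "\<alpha> > 0" and l: "l \<ge> 0" and s: "s > 0"
    and pq: "p > 1" "q > 1" "1 / p + 1 / q = 1"
    and d1: "\<And>u. u \<in> closed_segment y x \<Longrightarrow> (f has_real_derivative f' u) (at u)"
    and d2: "\<And>u. u \<in> closed_segment y x \<Longrightarrow> (f' has_real_derivative f'' u) (at u)"
    and conv: "s_convex_on s (closed_segment y x) (\<lambda>u. \<bar>f'' u\<bar> powr q)"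
  shows "\<bar>\<bar>x - y\<bar> powr \<alpha> * ((1 - l) * f x + l * f y) - (1 / (\<alpha> + 1) - l) * (x - y) * \<bar>x - y\<bar> powr \<alpha> * f' x
      - \<alpha> * integral (closed_segment y x) (\<lambda>u. \<bar>u - y\<bar> powr (\<alpha> - 1) * f u)\<bar>
    \<le> C4 \<alpha> l p powr (1 / p) * (\<bar>x - y\<bar> powr (\<alpha> + 2) / (\<alpha> + 1) *
        ((\<bar>f'' x\<bar> powr q + \<bar>f'' y\<bar> powr q) / (s + 1)) powr (1 / q))"
proof (cases "x = y")
  case True
  then show ?thesis by simp
next
  case False
  define h where "h = x - y"
  have h: "h \<noteq> 0" using False by (simp add: h_def)
  have seg: "y + t * h \<in> closed_segment y x" if "t \<in> {0..1}" for t
    using that by (auto simp: closed_segment_real_eq h_def)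
  \<comment> \<open>Dividing by \<open>h\<^sup>2\<close> absorbs the two chain rule factors, so that
    the second derivative is \<open>f''\<close> along the segment with coefficient 1.\<close>
  define \<phi> where "\<phi> = (\<lambda>t. f (y + t * h) / h\<^sup>2)"
  define \<phi>' where "\<phi>' = (\<lambda>t. f' (y + t * h) / h)"
  define \<phi>'' where "\<phi>'' = (\<lambda>t. f'' (y + t * h))"
  define M where "M = integral {0..1} (\<lambda>t. t powr (\<alpha> - 1) * f (y + t * h))"
  have D: "((\<lambda>t. F (y + t * h)) has_real_derivative F' (y + t * h) * h) (at t)"
    if "\<And>u. u \<in> closed_segment y x \<Longrightarrow> (F has_real_derivative F' u) (at u)" "t \<in> {0..1}" for F F' t
    by (rule DERIV_chain2[where f = F and g = "\<lambda>t. y + t * h", OF that(1)[OF seg[OF that(2)]]])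
      (auto intro!: derivative_eq_intros)
  have D1: "(\<phi> has_real_derivative \<phi>' t) (at t)" if "t \<in> {0..1}" for t
    using DERIV_cdivide[OF D[OF d1 that], of "h\<^sup>2"] h
    by (simp add: \<phi>_def \<phi>'_def power2_eq_square)
  have D2: "(\<phi>' has_real_derivative \<phi>'' t) (at t)" if "t \<in> {0..1}" for t
    using DERIV_cdivide[OF D[OF d2 that], of h] h
    by (simp add: \<phi>'_def \<phi>''_def)
  note parts = kernel_by_parts[OF \<alpha> D1 D2]
  have M\<phi>: "integral {0..1} (\<lambda>t. t powr (\<alpha> - 1) * \<phi> t) = M / h\<^sup>2"
    by (simp add: \<phi>_def M_def)
  have "(\<lambda>t. t powr (\<alpha> - 1) * f (y + t * h)) integrable_on {0..1}"
    using integrable_on_mult_left[OF parts(1), of "h\<^sup>2"] h by (simp add: \<phi>_def)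
  then have "((\<lambda>t. t powr (\<alpha> - 1) * f (y + t * (x - y))) has_integral M) {0..1}"
    unfolding M_def h_def by (rule integrable_integral)
  from integral_unique[OF has_integral_closed_segment[OF False this]]
  have IM: "integral (closed_segment y x) (\<lambda>u. \<bar>u - y\<bar> powr (\<alpha> - 1) * f u) = \<bar>h\<bar> powr \<alpha> * M"
    by (simp add: h_def)
  define N where "N = ((\<alpha> + 1) * l - 1) * \<phi>' 1 + (\<alpha> + 1) *
      ((1 - l) * \<phi> 1 + l * \<phi> 0 - \<alpha> * (M / h\<^sup>2))"
  have N: "\<bar>N\<bar> \<le> C4 \<alpha> l p powr (1 / p) * ((\<bar>f'' x\<bar> powr q + \<bar>f'' y\<bar> powr q) / (s + 1)) powr (1 / q)"
  proof (rule kernel_integral_bound[OF \<alpha> l s pq])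
    show "((\<lambda>t. t * ((\<alpha> + 1) * l - t powr \<alpha>) * \<phi>'' t) has_integral N) {0..1}"
      using parts(2)[of l] unfolding N_def M\<phi> .
    show "\<bar>\<phi>'' t\<bar> powr q \<le> t powr s * \<bar>f'' x\<bar> powr q + (1 - t) powr s * \<bar>f'' y\<bar> powr q"
      if "t \<in> {0..1}" for t
    proof -
      have "y + t * h = t * x + (1 - t) * y" by (simp add: h_def algebra_simps)
      then show ?thesis
        using conv that unfolding s_convex_on_def \<phi>''_def by auto
    qed
  qed auto
  have pow: "\<bar>h\<bar> powr (\<alpha> + 2) = \<bar>h\<bar> powr \<alpha> * h\<^sup>2"
    using h by (simp add: powr_add powr_numeral)
  \<comment> \<open>This undoes the scaling of \<open>\<phi>\<close>; a further factor
    \<open>\<bar>h\<bar> powr \<alpha>\<close> then accounts for the power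
    \<open>\<alpha> + 2\<close> in the bound.\<close>
  have scaled_N: "h\<^sup>2 / (\<alpha> + 1) * N = (1 - l) * f x + l * f y - (1 / (\<alpha> + 1) - l) * h * f' x - \<alpha> * M"
  proof -
    have "\<phi> 1 = f x / h\<^sup>2" "\<phi> 0 = f y / h\<^sup>2" "\<phi>' 1 = f' x * h / h\<^sup>2"
      using h by (auto simp: \<phi>_def \<phi>'_def h_def power2_eq_square)
    then have "N = (((\<alpha> + 1) * l - 1) * f' x * h + (\<alpha> + 1) * ((1 - l) * f x + l * f y - \<alpha> * M)) / h\<^sup>2"
      by (simp add: N_def add_divide_distrib diff_divide_distrib right_diff_distrib distrib_left)
    then have "h\<^sup>2 / (\<alpha> + 1) * N =
        (((\<alpha> + 1) * l - 1) * f' x * h + (\<alpha> + 1) * ((1 - l) * f x + l * f y - \<alpha> * M)) / (\<alpha> + 1)"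
      using h by simp
    also have "\<dots> = (1 - l) * f x + l * f y - (1 / (\<alpha> + 1) - l) * h * f' x - \<alpha> * M"
      using \<alpha> by (simp add: field_simps)
    finally show ?thesis .
  qed
  have "\<bar>h\<bar> powr \<alpha> * ((1 - l) * f x + l * f y) - (1 / (\<alpha> + 1) - l) * h * \<bar>h\<bar> powr \<alpha> * f' x
      - \<alpha> * (\<bar>h\<bar> powr \<alpha> * M) = \<bar>h\<bar> powr \<alpha> * (h\<^sup>2 / (\<alpha> + 1) * N)"
    unfolding scaled_N by (simp add: right_diff_distrib mult_ac)
  also have "\<dots> = \<bar>h\<bar> powr (\<alpha> + 2) / (\<alpha> + 1) * N"
    by (simp add: pow)
  finally have "\<bar>h\<bar> powr \<alpha> * ((1 - l) * f x + l * f y) - (1 / (\<alpha> + 1) - l) * h * \<bar>h\<bar> powr \<alpha> * f' x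
      - \<alpha> * (\<bar>h\<bar> powr \<alpha> * M) = \<bar>h\<bar> powr (\<alpha> + 2) / (\<alpha> + 1) * N" .
  moreover have "\<bar>\<bar>h\<bar> powr (\<alpha> + 2) / (\<alpha> + 1) * N\<bar> \<le> \<bar>h\<bar> powr (\<alpha> + 2) / (\<alpha> + 1) *
      (C4 \<alpha> l p powr (1 / p) * ((\<bar>f'' x\<bar> powr q + \<bar>f'' y\<bar> powr q) / (s + 1)) powr (1 / q))"
    using \<alpha> N by (simp add: abs_mult divide_right_mono mult_left_mono)
  ultimately show ?thesis
    unfolding IM h_def[symmetric] by (simp add: mult_ac)
qed

section \<open>Combining the two endpoints\<close>

theorem theorem7:
  fixes f :: "real \<Rightarrow> real" and I :: "real set" and a b s q p x l \<alpha> :: real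
  assumes "is_interval I" and "I \<subseteq> {0..}"
    and "a \<in> interior I" and "b \<in> interior I" and "a < b"
    and "f differentiable_on interior I"
    and "deriv f differentiable_on interior I"
    and "deriv (deriv f) absolutely_integrable_on {a..b}"
    and "0 < s" and "s \<le> 1" and "q > 1" and "p = q / (q - 1)"
    and "s_convex_on s {a..b} (\<lambda>t. \<bar>deriv (deriv f) t\<bar> powr q)"
    and "x \<in> {a..b}" and "l \<in> {0..1}" and "\<alpha> > 0"
  shows "\<bar>I_fun f x l \<alpha> a b\<bar> \<le>
    C4 \<alpha> l p powr (1 / p) *
      ((x - a) powr (\<alpha> + 2) / ((\<alpha> + 1) * (b - a))
         * ((\<bar>deriv (deriv f) x\<bar> powr q + \<bar>deriv (deriv f) a\<bar> powr q) / (s + 1)) powr (1 / q)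
       + (b - x) powr (\<alpha> + 2) / ((\<alpha> + 1) * (b - a))
         * ((\<bar>deriv (deriv f) x\<bar> powr q + \<bar>deriv (deriv f) b\<bar> powr q) / (s + 1)) powr (1 / q))"
proof -
  have p: "p > 1" "1 / p + 1 / q = 1"
    using assms(11) by (auto simp: assms(12) field_simps)
  \<comment> \<open>With \<open>{a..b}\<close> inside the open set \<open>interior I\<close>, the
    derivatives at \<open>a\<close> and \<open>b\<close> are two-sided.\<close>
  have "convex (interior I)"
    using assms(1) by (simp add: is_interval_convex convex_interior)
  then have sub: "{a..b} \<subseteq> interior I"
    using assms(3-5) closed_segment_subset[of a "interior I" b]
    by (simp add: closed_segment_eq_real_ivl)
  have D: "(g has_real_derivative deriv g u) (at u)"
    if "g differentiable_on interior I" "u \<in> {a..b}" for g u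
  proof -
    have "u \<in> interior I" using sub that by blast
    then have "g differentiable at u"
      using that differentiable_on_eq_differentiable_at[of "interior I" g] by simp
    then show ?thesis
      by (simp add: DERIV_deriv_iff_real_differentiable)
  qed
  note D1 = D[OF assms(6)] and D2 = D[OF assms(7)]
  have mono: "s_convex_on s S (\<lambda>t. \<bar>deriv (deriv f) t\<bar> powr q)" if "S \<subseteq> {a..b}" for S
    using assms(13) that unfolding s_convex_on_def by blast
  have seg: "closed_segment a x = {a..x}" "closed_segment b x = {x..b}"
    using assms(14) by (auto simp: closed_segment_eq_real_ivl)
  have subs: "{a..x} \<subseteq> {a..b}" "{x..b} \<subseteq> {a..b}"
    using assms(14) by auto
  have l: "l \<ge> 0" using assms(15) by simp
  define Ia where "Ia = integral {a..x} (\<lambda>t. (t - a) powr (\<alpha> - 1) * f t)"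
  define Ib where "Ib = integral {x..b} (\<lambda>t. (b - t) powr (\<alpha> - 1) * f t)"
  have Ia: "integral {a..x} (\<lambda>t. \<bar>t - a\<bar> powr (\<alpha> - 1) * f t) = Ia"
    unfolding Ia_def by (intro integral_cong) simp
  have Ib: "integral {x..b} (\<lambda>t. \<bar>t - b\<bar> powr (\<alpha> - 1) * f t) = Ib"
    unfolding Ib_def by (intro integral_cong) simp
  have powr_Suc: "t powr (\<alpha> + 1) = t * t powr \<alpha>" if "t \<ge> 0" for t :: real
    using that assms(16) by (cases "t = 0") (auto simp: powr_add)
  \<comment> \<open>\<open>Ta\<close> and \<open>Tb\<close> are the shares of the endpoints in
    \<open>(b - a) * I_fun f x l \<alpha> a b\<close>, in the shape of
    \<open>one_sided_bound\<close> with \<open>y = a\<close> and \<open>y = b\<close>.\<close>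
  define Ta where "Ta = (x - a) powr \<alpha> * ((1 - l) * f x + l * f a)
      - (1 / (\<alpha> + 1) - l) * (x - a) * (x - a) powr \<alpha> * deriv f x - \<alpha> * Ia"
  define Tb where "Tb = (b - x) powr \<alpha> * ((1 - l) * f x + l * f b)
      - (1 / (\<alpha> + 1) - l) * (x - b) * (b - x) powr \<alpha> * deriv f x - \<alpha> * Ib"
  define Ra where "Ra = (x - a) powr (\<alpha> + 2) / (\<alpha> + 1) *
      ((\<bar>deriv (deriv f) x\<bar> powr q + \<bar>deriv (deriv f) a\<bar> powr q) / (s + 1)) powr (1 / q)"
  define Rb where "Rb = (b - x) powr (\<alpha> + 2) / (\<alpha> + 1) *
      ((\<bar>deriv (deriv f) x\<bar> powr q + \<bar>deriv (deriv f) b\<bar> powr q) / (s + 1)) powr (1 / q)"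
  have Ta: "\<bar>Ta\<bar> \<le> C4 \<alpha> l p powr (1 / p) * Ra"
    using one_sided_bound[OF assms(16) l assms(9) p(1) assms(11) p(2), of a x f "deriv f" "deriv (deriv f)"]
      D1 D2 mono subs assms(14) unfolding seg Ia Ta_def Ra_def by auto
  have Tb: "\<bar>Tb\<bar> \<le> C4 \<alpha> l p powr (1 / p) * Rb"
    using one_sided_bound[OF assms(16) l assms(9) p(1) assms(11) p(2), of b x f "deriv f" "deriv (deriv f)"]
      D1 D2 mono subs assms(14) unfolding seg Ib Tb_def Rb_def by auto
  \<comment> \<open>The functional equation cancels the \<open>1 / Gamma \<alpha>\<close> of the
    fractional integrals and leaves the factor \<open>\<alpha>\<close>.\<close>
  have "Gamma (\<alpha> + 1) = \<alpha> * Gamma \<alpha>" "Gamma \<alpha> > 0"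
    using assms(16) by (intro Gamma_plus1 Gamma_real_pos; auto elim!: nonpos_Ints_cases)+
  then have "Gamma (\<alpha> + 1) * (RL_minus \<alpha> x f a + RL_plus \<alpha> x f b) = \<alpha> * Ia + \<alpha> * Ib"
    by (simp add: RL_minus_def RL_plus_def Ia_def Ib_def field_simps)
  moreover have "I_fun f x l \<alpha> a b =
      ((1 - l) * ((x - a) powr \<alpha> + (b - x) powr \<alpha>) * f x
       + l * ((x - a) powr \<alpha> * f a + (b - x) powr \<alpha> * f b)
       + (1 / (\<alpha> + 1) - l) * ((b - x) * (b - x) powr \<alpha> - (x - a) * (x - a) powr \<alpha>) * deriv f x
       - Gamma (\<alpha> + 1) * (RL_minus \<alpha> x f a + RL_plus \<alpha> x f b)) / (b - a)"
    using assms(14)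
    by (simp add: I_fun_def powr_Suc flip: diff_divide_distrib add_divide_distrib)
  \<comment> \<open>A polynomial identity, with \<open>P\<close> and \<open>Q\<close> for the two
    powers of exponent \<open>\<alpha>\<close> and \<open>k\<close> for
    \<open>1 / (\<alpha> + 1) - l\<close>.\<close>
  moreover have "(1 - l) * (P + Q) * f x + l * (P * f a + Q * f b)
      + k * ((b - x) * Q - (x - a) * P) * deriv f x - (\<alpha> * Ia + \<alpha> * Ib)
      = (P * ((1 - l) * f x + l * f a) - k * (x - a) * P * deriv f x - \<alpha> * Ia)
      + (Q * ((1 - l) * f x + l * f b) - k * (x - b) * Q * deriv f x - \<alpha> * Ib)" for P Q k
    by (simp add: algebra_simps)
  ultimately have "I_fun f x l \<alpha> a b = (Ta + Tb) / (b - a)"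
    by (simp only: Ta_def Tb_def)
  then have "\<bar>I_fun f x l \<alpha> a b\<bar> = \<bar>Ta + Tb\<bar> / (b - a)"
    using assms(5) by simp
  also have "\<dots> \<le> (C4 \<alpha> l p powr (1 / p) * Ra + C4 \<alpha> l p powr (1 / p) * Rb) / (b - a)"
    using Ta Tb assms(5) by (intro divide_right_mono) auto
  also have "\<dots> = C4 \<alpha> l p powr (1 / p) * (Ra / (b - a) + Rb / (b - a))"
    by (simp add: add_divide_distrib distrib_left)
  finally show ?thesis
    by (simp add: Ra_def Rb_def)
qed

end
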